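(* For overlay D2D, the operational region of Scheme 3-d (distance-based mode selection, D2D links always active) equals $\mathcal R^{\text{3-d}}=\mathcal R^1\cup\hat{\mathcal R}^{\text{3-d}}$, where $\mathcal R^1=\{c_1>e^{c_2}\}$ and $$\hat{\mathcal R}^{\text{3-d}}=\left\{\sqrt{2c_2e}<c_1<\frac{e^{c_2}}{2(1-c_2)},\ \frac12<c_2<1\right\}\cup\{c_1>\sqrt{2c_2e},\ c_2\ge1\}.$$ For operational points in $\hat{\mathcal R}^{\text{3-d}}$ the optimal D2D mode selection probability is $p^*=\sqrt{x^*/c_2}<1$, where $x^*$ is the unique solution of $\sqrt{x}\,e^{-x}(1-x)=\sqrt{c_2}/(2c_1)$ with $1/2<x<\min\{1,c_2\}$; for all other operational points of $\mathcal R^{\text{3-d}}$, $p^*=1$.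
   Context: A D2D-enabled cellular network has D2D mode selection probability $p\in(0,1]$; in Scheme 3 the D2D channel access probability is fixed to $1$. For overlay D2D with distance-based mode selection the average user rate is $R=R_{\mathrm{noD2D}}(1+wf(p))$ with $R_{\mathrm{noD2D}},w>0$ independent of $p$ and $$f(p)=c_1p^2e^{-c_2p^2}-p.$$ The operational point is encoded by $(c_1,c_2)\in(0,\infty)^2$; all displayed sets are subsets of $(0,\infty)^2$. The operational region $\mathcal R^{\text{3-d}}$ is the set of operational points for which some $p\in(0,1]$ gives $R>R_{\mathrm{noD2D}}$, i.e. $f(p)>0$. $p^*$ is the maximizer of $R$ (equivalently of $f$) over $p\in(0,1]$. $\mathcal R^1$ is the operational region of the baseline scheme with $p=1$. *)

theory Defs
  imports Complex_Main
begin

definition gain :: "real \<Rightarrow> real \<Rightarrow> real \<Rightarrow> real" where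
  "gain c1 c2 p = c1 * p\<^sup>2 * exp (- c2 * p\<^sup>2) - p"

definition avg_rate :: "real \<Rightarrow> real \<Rightarrow> real \<Rightarrow> real \<Rightarrow> real \<Rightarrow> real" where
  "avg_rate R0 w c1 c2 p = R0 * (1 + w * gain c1 c2 p)"

text \<open>Here \<open>R0\<close> is the rate without D2D links. Operational points are the pairs \<open>(c1, c2)\<close> of
  positive reals; an operational region collects those at which D2D strictly improves on \<open>R0\<close>.\<close>

definition region_3d :: "real \<Rightarrow> real \<Rightarrow> (real \<times> real) set" where
  "region_3d R0 w =
     {(c1, c2). 0 < c1 \<and> 0 < c2 \<and> (\<exists>p\<in>{0<..1}. avg_rate R0 w c1 c2 p > R0)}"

text \<open>The baseline scheme has no mode selection, that is, \<open>p = 1\<close>.\<close>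

definition region_1 :: "real \<Rightarrow> real \<Rightarrow> (real \<times> real) set" where
  "region_1 R0 w = {(c1, c2). 0 < c1 \<and> 0 < c2 \<and> avg_rate R0 w c1 c2 1 > R0}"

definition region_3d_hat :: "(real \<times> real) set" where
  "region_3d_hat =
     {(c1, c2). 0 < c1 \<and> 0 < c2 \<and> sqrt (2 * c2 * exp 1) < c1 \<and>
        c1 < exp c2 / (2 * (1 - c2)) \<and> 1 / 2 < c2 \<and> c2 < 1} \<union>
     {(c1, c2). 0 < c1 \<and> 0 < c2 \<and> c1 > sqrt (2 * c2 * exp 1) \<and> c2 \<ge> 1}"

definition optimal_prob :: "real \<Rightarrow> real \<Rightarrow> real \<Rightarrow> real \<Rightarrow> real \<Rightarrow> bool" where
  "optimal_prob R0 w c1 c2 p \<longleftrightarrow> is_arg_max (avg_rate R0 w c1 c2) (\<lambda>q. q \<in> {0<..1}) p"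

definition x_star_eq :: "real \<Rightarrow> real \<Rightarrow> real \<Rightarrow> bool" where
  "x_star_eq c1 c2 x \<longleftrightarrow>
     sqrt x * exp (- x) * (1 - x) = sqrt c2 / (2 * c1) \<and> 1 / 2 < x \<and> x < min 1 c2"

end

theory Submission
  imports Defs
begin

text \<open>Write \<open>gain p = p * (c1 * g p - 1)\<close> with \<open>g p = p * exp (- c2 * p\<^sup>2)\<close>, which increases while
  \<open>c2 * p\<^sup>2 \<le> 1 / 2\<close> and is at most \<open>1 / sqrt (2 * c2 * exp 1)\<close>. Hence, once the gain is positive at
  \<open>c2 * p\<^sup>2 = 1 / 2\<close>, smaller \<open>p\<close> are worse, although the gain is not monotone there. Beyond that
  point the derivative of the gain is strictly decreasing as long as \<open>c2 * p\<^sup>2 < 1\<close> and negative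
  afterwards, so the gain has a single peak: at the critical point, or at \<open>p = 1\<close> if the critical
  point exceeds 1. The substitution \<open>x = c2 * p\<^sup>2\<close> turns the critical point equation into
  that for \<open>x*\<close>.\<close>

section \<open>Positivity and comparison of the gain\<close>

lemma gain_alt: "gain c1 c2 p = p * (c1 * (p * exp (- c2 * p\<^sup>2)) - 1)"
  by (simp add: gain_def power2_eq_square algebra_simps)

lemma gain_pos_iff:
  assumes "0 < p"
  shows "0 < gain c1 c2 p \<longleftrightarrow> 1 < c1 * (p * exp (- c2 * p\<^sup>2))"
  using assms by (simp add: gain_alt zero_less_mult_iff)

lemma avg_rate_less_iff:
  assumes "0 < R0" "0 < w"
  shows "avg_rate R0 w c1 c2 p < avg_rate R0 w c1 c2 q \<longleftrightarrow> gain c1 c2 p < gain c1 c2 q"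
  using assms by (simp add: avg_rate_def)

lemma avg_rate_gt_iff:
  assumes "0 < R0" "0 < w"
  shows "R0 < avg_rate R0 w c1 c2 p \<longleftrightarrow> 0 < gain c1 c2 p"
proof -
  have "avg_rate R0 w c1 c2 p - R0 = (R0 * w) * gain c1 c2 p"
    by (simp add: avg_rate_def algebra_simps)
  moreover have "0 < R0 * w" using assms by simp
  ultimately show ?thesis by (metis diff_gt_0_iff_gt zero_less_mult_pos mult_pos_pos)
qed

lemma optimal_prob_unique:
  assumes "0 < R0" "0 < w" "p0 \<in> {0<..1}"
    and "\<And>p. p \<in> {0<..1} \<Longrightarrow> p \<noteq> p0 \<Longrightarrow> gain c1 c2 p < gain c1 c2 p0"
  shows "optimal_prob R0 w c1 c2 p \<longleftrightarrow> p = p0"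
  using assms unfolding optimal_prob_def is_arg_max_def avg_rate_less_iff[OF assms(1,2)]
  by (metis less_asym)

section \<open>The factor \<open>p * exp (- c * p\<^sup>2)\<close> and its peak\<close>

lemma mult_exp_neg_square_less:
  fixes c p q :: real
  assumes "0 < p" "p < q" "c * q\<^sup>2 \<le> 1 / 2"
  shows "p * exp (- c * p\<^sup>2) < q * exp (- c * q\<^sup>2)"
proof -
  \<comment> \<open>In terms of the ratio \<open>t\<close> the claim is
    \<open>t < exp (- (c * q\<^sup>2 * (1 - t\<^sup>2)))\<close>. By
    \<open>exp y \<ge> 1 + y\<close> and \<open>c * q\<^sup>2 \<le> 1 / 2\<close> it reduces to
    \<open>0 < (1 - t)\<^sup>2\<close>.\<close>
  define t where "t = p / q"
  have t: "0 < t" "t < 1" "p = t * q" using assms by (auto simp: t_def)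
  have "0 < (1 - t)\<^sup>2" using t by simp
  then have "t < 1 - (1 - t\<^sup>2) / 2" by (simp add: power2_eq_square field_simps)
  also have "\<dots> \<le> 1 - c * q\<^sup>2 * (1 - t\<^sup>2)"
  proof -
    have "0 \<le> 1 - t\<^sup>2" using t by (simp add: power_le_one)
    from mult_right_mono[OF assms(3) this] show ?thesis by simp
  qed
  also have "\<dots> \<le> exp (- (c * q\<^sup>2 * (1 - t\<^sup>2)))"
    using exp_ge_add_one_self[of "- (c * q\<^sup>2 * (1 - t\<^sup>2))"] by simp
  also have "- (c * q\<^sup>2 * (1 - t\<^sup>2)) = - c * q\<^sup>2 - (- c * p\<^sup>2)"
    by (simp add: t power_mult_distrib algebra_simps)
  finally have "t < exp (- c * q\<^sup>2) / exp (- c * p\<^sup>2)" by (simp only: exp_diff)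
  then have "t * exp (- c * p\<^sup>2) < exp (- c * q\<^sup>2)" by (simp add: pos_less_divide_eq)
  then have "q * (t * exp (- c * p\<^sup>2)) < q * exp (- c * q\<^sup>2)"
    using assms by (intro mult_strict_left_mono) auto
  then show ?thesis by (simp add: t mult_ac)
qed

text \<open>The mirrored estimate: the ratio \<open>t = q / p\<close> is now at least 1, and
  \<open>0 \<le> (t - 1)\<^sup>2\<close> gives
  \<open>t \<le> 1 + (t\<^sup>2 - 1) / 2\<close>.\<close>

lemma mult_exp_neg_square_antimono:
  fixes c p q :: real
  assumes "0 < p" "p \<le> q" "1 / 2 \<le> c * p\<^sup>2"
  shows "q * exp (- c * q\<^sup>2) \<le> p * exp (- c * p\<^sup>2)"
proof -
  define t where "t = q / p"
  have t: "1 \<le> t" "q = t * p" using assms by (auto simp: t_def)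
  have "t \<le> 1 + (t\<^sup>2 - 1) / 2"
    using zero_le_power2[of "t - 1"] by (simp add: power2_eq_square field_simps)
  also have "\<dots> \<le> 1 + c * p\<^sup>2 * (t\<^sup>2 - 1)"
  proof -
    have "0 \<le> t\<^sup>2 - 1" using t by simp
    from mult_right_mono[OF assms(3) this] show ?thesis by simp
  qed
  also have "\<dots> \<le> exp (c * p\<^sup>2 * (t\<^sup>2 - 1))" by (rule exp_ge_add_one_self)
  also have "c * p\<^sup>2 * (t\<^sup>2 - 1) = - c * p\<^sup>2 - (- c * q\<^sup>2)"
    by (simp add: t power_mult_distrib algebra_simps)
  finally have "t \<le> exp (- c * p\<^sup>2) / exp (- c * q\<^sup>2)" by (simp only: exp_diff)
  then have "t * exp (- c * q\<^sup>2) \<le> exp (- c * p\<^sup>2)" by (simp add: pos_le_divide_eq)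
  then have "p * (t * exp (- c * q\<^sup>2)) \<le> p * exp (- c * p\<^sup>2)"
    using assms by (intro mult_left_mono) auto
  then show ?thesis by (simp add: t mult_ac)
qed

text \<open>The peak value, taken at \<open>c * p\<^sup>2 = 1 / 2\<close>. Its reciprocal is the
  lower threshold for \<open>c1\<close> in \<open>region_3d_hat\<close>.\<close>

lemma mult_exp_neg_square_half:
  fixes c :: real
  assumes "0 < c"
  shows "1 / sqrt (2 * c) * exp (- c * (1 / sqrt (2 * c))\<^sup>2) = 1 / sqrt (2 * c * exp 1)"
proof -
  have "sqrt (exp 1) = exp (1 / 2 :: real)"
    by (rule real_sqrt_unique) (simp_all flip: exp_double)
  then show ?thesis
    using assms by (simp add: power_divide real_sqrt_mult exp_minus field_simps)
qed

lemma mult_exp_neg_square_le: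
  fixes c p :: real
  assumes "0 < c" "0 < p"
  shows "p * exp (- c * p\<^sup>2) \<le> 1 / sqrt (2 * c * exp 1)"
proof -
  define q where "q = 1 / sqrt (2 * c)"
  have q: "0 < q" "c * q\<^sup>2 = 1 / 2" using assms by (auto simp: q_def power_divide)
  have "p * exp (- c * p\<^sup>2) \<le> q * exp (- c * q\<^sup>2)"
    using mult_exp_neg_square_less[of p q c] mult_exp_neg_square_antimono[of q p c] assms q
    by (cases "p < q") (metis less_imp_le order_refl not_less)+
  then show ?thesis using mult_exp_neg_square_half[OF assms(1)] by (simp add: q_def)
qed

section \<open>The single peak of the gain\<close>

lemma gain_less_before_half:
  assumes "0 < p" "p < q" "c2 * q\<^sup>2 \<le> 1 / 2" "0 < c1" "0 < gain c1 c2 q"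
  shows "gain c1 c2 p < gain c1 c2 q"
proof -
  let ?g = "\<lambda>p. c1 * (p * exp (- c2 * p\<^sup>2)) - 1"
  have "?g p < ?g q" using mult_exp_neg_square_less[OF assms(1-3)] assms(4) by simp
  \<comment> \<open>The bracket moves from \<open>p\<close> to \<open>q\<close> first and the
    prefactor second. Only the second move needs a positive bracket, and that is the one at
    \<open>q\<close>; the gain at \<open>p\<close> may have either sign.\<close>
  then have "p * ?g p < p * ?g q" using assms(1) by (intro mult_strict_left_mono)
  also have "\<dots> < q * ?g q"
    using gain_pos_iff[of q c1 c2] assms by (intro mult_strict_right_mono) auto
  finally show ?thesis by (simp only: gain_alt)
qed

text \<open>The derivative of the gain without its constant term \<open>-1\<close>, so critical
  points are the solutions of \<open>marginal c1 c2 p = 1\<close>.\<close>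

definition marginal :: "real \<Rightarrow> real \<Rightarrow> real \<Rightarrow> real" where
  "marginal c1 c2 p = 2 * c1 * (p * exp (- c2 * p\<^sup>2)) * (1 - c2 * p\<^sup>2)"

lemma DERIV_gain: "(gain c1 c2 has_real_derivative marginal c1 c2 p - 1) (at p)"
  unfolding gain_def[abs_def] marginal_def
  by (auto intro!: derivative_eq_intros simp: power2_eq_square algebra_simps)

text \<open>The factor \<open>1 - c2 * p\<^sup>2\<close> decreases strictly and
  \<open>p * exp (- c2 * p\<^sup>2)\<close> does not increase past its peak. The bound by 1 keeps
  the former nonnegative at \<open>p\<close>; \<open>q\<close> may lie beyond its zero.\<close>

lemma marginal_strict_antimono:
  assumes "0 < c1" "0 < c2" "0 < p" "p < q" "1 / 2 \<le> c2 * p\<^sup>2" "c2 * p\<^sup>2 \<le> 1"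
  shows "marginal c1 c2 q < marginal c1 c2 p"
proof -
  have "c2 * p\<^sup>2 < c2 * q\<^sup>2" using assms by (simp add: power_strict_mono)
  then have "marginal c1 c2 q < 2 * c1 * (q * exp (- c2 * q\<^sup>2)) * (1 - c2 * p\<^sup>2)"
    unfolding marginal_def using assms by (intro mult_strict_left_mono) auto
  also have "\<dots> \<le> marginal c1 c2 p"
    unfolding marginal_def using assms mult_exp_neg_square_antimono[of p q c2]
    by (intro mult_right_mono mult_left_mono) auto
  finally show ?thesis .
qed

lemma gain_less_after_half:
  assumes "0 < c1" "0 < c2" "0 < p" "p < q" "1 / 2 \<le> c2 * p\<^sup>2" "c2 * q\<^sup>2 \<le> 1"
    and "1 \<le> marginal c1 c2 q"
  shows "gain c1 c2 p < gain c1 c2 q"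
proof (rule DERIV_pos_imp_increasing_open[OF assms(4)])
  fix r assume r: "p < r" "r < q"
  have "p\<^sup>2 \<le> r\<^sup>2" "r\<^sup>2 \<le> q\<^sup>2" using assms r by (auto intro!: power_mono)
  then have "c2 * p\<^sup>2 \<le> c2 * r\<^sup>2" "c2 * r\<^sup>2 \<le> c2 * q\<^sup>2" using assms by simp_all
  then have "1 / 2 \<le> c2 * r\<^sup>2" "c2 * r\<^sup>2 \<le> 1" using assms by linarith+
  then have "marginal c1 c2 q < marginal c1 c2 r"
    using assms r by (intro marginal_strict_antimono) auto
  then show "\<exists>y. (gain c1 c2 has_real_derivative y) (at r) \<and> 0 < y"
    using DERIV_gain[of c1 c2 r] assms by (intro exI[of _ "marginal c1 c2 r - 1"]) auto
qed (auto intro!: continuous_at_imp_continuous_on DERIV_isCont[OF DERIV_gain])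

text \<open>Since \<open>marginal_strict_antimono\<close> bounds \<open>c2 * p\<^sup>2\<close> only
  at the left point, a single comparison covers everything to the right of the peak.\<close>

lemma gain_greater_after_peak:
  assumes "0 < c1" "0 < c2" "0 < p" "p < q" "1 / 2 \<le> c2 * p\<^sup>2" "c2 * p\<^sup>2 \<le> 1"
    and "marginal c1 c2 p \<le> 1"
  shows "gain c1 c2 q < gain c1 c2 p"
proof (rule DERIV_neg_imp_decreasing_open[OF assms(4)])
  fix r assume r: "p < r" "r < q"
  have "marginal c1 c2 r < marginal c1 c2 p"
    using assms r by (intro marginal_strict_antimono) auto
  then show "\<exists>y. (gain c1 c2 has_real_derivative y) (at r) \<and> y < 0"
    using DERIV_gain[of c1 c2 r] assms by (intro exI[of _ "marginal c1 c2 r - 1"]) auto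
qed (auto intro!: continuous_at_imp_continuous_on DERIV_isCont[OF DERIV_gain])

lemma gain_half_pos_iff:
  assumes "0 < c2"
  shows "0 < gain c1 c2 (1 / sqrt (2 * c2)) \<longleftrightarrow> sqrt (2 * c2 * exp 1) < c1"
  using assms
  by (subst gain_pos_iff) (simp_all only: mult_exp_neg_square_half, simp_all add: field_simps)

lemma gain_less_before_peak:
  assumes "0 < c1" "0 < c2" "0 < p" "p < q" "1 / 2 \<le> c2 * q\<^sup>2" "c2 * q\<^sup>2 \<le> 1"
    and "1 \<le> marginal c1 c2 q" "sqrt (2 * c2 * exp 1) < c1"
  shows "gain c1 c2 p < gain c1 c2 q"
proof (cases "1 / 2 \<le> c2 * p\<^sup>2")
  case True
  with assms show ?thesis by (intro gain_less_after_half)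
next
  case False
  \<comment> \<open>The peak of \<open>p * exp (- c2 * p\<^sup>2)\<close>. The bound on
    \<open>c1\<close> makes the gain positive there, so the comparisons below and above
    \<open>r\<close> can be chained.\<close>
  define r where "r = 1 / sqrt (2 * c2)"
  have r: "0 < r" "c2 * r\<^sup>2 = 1 / 2" using assms by (auto simp: r_def power_divide)
  have "c2 * p\<^sup>2 < c2 * r\<^sup>2" "c2 * r\<^sup>2 \<le> c2 * q\<^sup>2" using False r assms by linarith+
  then have "p\<^sup>2 < r\<^sup>2" "r\<^sup>2 \<le> q\<^sup>2" using assms by simp_all
  then have *: "p < r" "r \<le> q"
    using assms r power2_less_imp_less[of p r] power2_le_imp_le[of r q] by auto
  have "gain c1 c2 p < gain c1 c2 r"
    using assms r * gain_half_pos_iff[of c2 c1] by (intro gain_less_before_half) (auto simp: r_def)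
  also have "\<dots> \<le> gain c1 c2 q"
    using * assms r gain_less_after_half[of c1 c2 r q] by (cases "r = q") auto
  finally show ?thesis .
qed

section \<open>Thresholds for \<open>c1\<close> and the critical point equation\<close>

lemma gain_one_pos_iff: "0 < gain c1 c2 1 \<longleftrightarrow> exp c2 < c1"
  by (simp add: gain_def exp_minus field_simps)

text \<open>A positive gain forces \<open>c1\<close> above the reciprocal of the peak value, so this
  threshold holds throughout the operational region.\<close>

lemma gain_pos_imp_sqrt_less:
  assumes "0 < c1" "0 < c2" "0 < p" "0 < gain c1 c2 p"
  shows "sqrt (2 * c2 * exp 1) < c1"
proof -
  have "1 < c1 * (p * exp (- c2 * p\<^sup>2))" using assms gain_pos_iff by blast
  also have "\<dots> \<le> c1 * (1 / sqrt (2 * c2 * exp 1))"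
    using assms mult_exp_neg_square_le by (intro mult_left_mono) auto
  finally show ?thesis using assms by (simp add: field_simps)
qed

lemma marginal_one_less:
  assumes "0 < c1" "1 \<le> c2"
  shows "marginal c1 c2 1 < 1"
proof -
  have "marginal c1 c2 1 \<le> 0" using assms by (auto simp: marginal_def mult_le_0_iff)
  then show ?thesis by simp
qed

text \<open>Both pieces of the region express one condition, that the gain has negative derivative
  at \<open>p = 1\<close>. It is the upper bound on \<open>c1\<close> when \<open>c2 < 1\<close> and
  automatic when \<open>c2 \<ge> 1\<close>.\<close>

lemma region_3d_hat_iff:
  "(c1, c2) \<in> region_3d_hat \<longleftrightarrow>
     0 < c1 \<and> 1 / 2 < c2 \<and> sqrt (2 * c2 * exp 1) < c1 \<and> marginal c1 c2 1 < 1"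
proof -
  have "c1 < exp c2 / (2 * (1 - c2)) \<longleftrightarrow> marginal c1 c2 1 < 1" if "c2 < 1"
    using that by (simp add: marginal_def exp_minus field_simps)
  then show ?thesis using marginal_one_less[of c1 c2] unfolding region_3d_hat_def by fastforce
qed

text \<open>Under \<open>x = c2 * p\<^sup>2\<close> the equation for \<open>x\<close> is
  \<open>marginal c1 c2 p = 1\<close> scaled by \<open>sqrt c2 / (2 * c1)\<close>, and
  \<open>x < c2\<close> becomes \<open>p < 1\<close>.\<close>

lemma x_star_eq_iff:
  assumes "0 < c1" "0 < c2"
  shows "x_star_eq c1 c2 (c2 * p\<^sup>2) \<and> 0 < p \<longleftrightarrow>
    marginal c1 c2 p = 1 \<and> 1 / 2 < c2 * p\<^sup>2 \<and> c2 * p\<^sup>2 < 1 \<and> 0 < p \<and> p < 1"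
proof (cases "0 < p")
  case True
  have "sqrt (c2 * p\<^sup>2) * exp (- (c2 * p\<^sup>2)) * (1 - c2 * p\<^sup>2) = sqrt c2 / (2 * c1)
      \<longleftrightarrow> marginal c1 c2 p = 1"
  proof -
    have "sqrt (c2 * p\<^sup>2) * exp (- (c2 * p\<^sup>2)) * (1 - c2 * p\<^sup>2)
        = marginal c1 c2 p * (sqrt c2 / (2 * c1))"
      using assms True by (simp add: marginal_def real_sqrt_mult)
    then show ?thesis using assms by simp
  qed
  moreover have "c2 * p\<^sup>2 < c2 \<longleftrightarrow> p < 1"
    using assms True by (simp add: power_less_one_iff)
  ultimately show ?thesis using True by (auto simp: x_star_eq_def)
qed simp

lemma x_star_eq_unique:
  assumes "0 < c1" "0 < c2" "0 < p" "0 < q"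
    and p: "marginal c1 c2 p = 1" "1 / 2 < c2 * p\<^sup>2" "c2 * p\<^sup>2 < 1"
    and q: "marginal c1 c2 q = 1" "1 / 2 < c2 * q\<^sup>2" "c2 * q\<^sup>2 < 1"
  shows "p = q"
  using marginal_strict_antimono[of c1 c2 p q] marginal_strict_antimono[of c1 c2 q p] assms
  by (cases p q rule: linorder_cases) auto

lemma critical_point_exists:
  assumes "0 < c1" "1 / 2 < c2" "sqrt (2 * c2 * exp 1) < c1" "marginal c1 c2 1 < 1"
  obtains p where "marginal c1 c2 p = 1" "1 / 2 < c2 * p\<^sup>2" "c2 * p\<^sup>2 < 1" "0 < p" "p < 1"
proof -
  define r where "r = 1 / sqrt (2 * c2)"
  \<comment> \<open>The right end of the range \<open>p < 1\<close>,
    \<open>c2 * p\<^sup>2 < 1\<close>. The marginal is below 1 there: it vanishes at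
    \<open>1 / sqrt c2\<close>, and at 1 the bound is assumed.\<close>
  define u where "u = min 1 (1 / sqrt c2)"
  have r: "0 < r" "c2 * r\<^sup>2 = 1 / 2" using assms by (auto simp: r_def power_divide)
  have u: "0 < u" "u \<le> 1" using assms by (auto simp: u_def)
  have u1: "c2 * u\<^sup>2 \<le> 1"
  proof -
    have "u\<^sup>2 \<le> (1 / sqrt c2)\<^sup>2" using u by (intro power_mono) (auto simp: u_def)
    then show ?thesis using assms by (simp add: power_divide field_simps)
  qed
  have "1 < sqrt (2 * c2)" "sqrt c2 < sqrt (2 * c2)" using assms by simp_all
  then have "r < u" using assms by (auto simp: r_def u_def intro!: divide_strict_left_mono)
  have mr: "1 < marginal c1 c2 r"
  proof -
    have "0 < gain c1 c2 r" using assms gain_half_pos_iff[of c2 c1] by (simp add: r_def)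
    then have "1 < c1 * (r * exp (- c2 * r\<^sup>2))" using r gain_pos_iff by blast
    \<comment> \<open>At \<open>r\<close> the factors 2 and
      \<open>1 - c2 * r\<^sup>2 = 1 / 2\<close> cancel, so the marginal is exactly the quantity just
      shown to exceed 1.\<close>
    then show ?thesis unfolding marginal_def r(2) by simp
  qed
  have mu: "marginal c1 c2 u < 1"
    using assms by (auto simp: u_def min_def marginal_def power_divide)
  have "\<exists>p. r \<le> p \<and> p \<le> u \<and> marginal c1 c2 p = 1"
    using mr mu \<open>r < u\<close>
    by (intro IVT2') (auto simp: marginal_def[abs_def] intro!: continuous_intros)
  then obtain p where "r \<le> p" "p \<le> u" and m: "marginal c1 c2 p = 1" by blast
  then have p: "r < p" "p < u" using mr mu by (auto simp: order.strict_iff_order)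
  have "r\<^sup>2 < p\<^sup>2" "p\<^sup>2 < u\<^sup>2" using p r by (auto intro!: power_strict_mono)
  then have "c2 * r\<^sup>2 < c2 * p\<^sup>2" "c2 * p\<^sup>2 < c2 * u\<^sup>2" using assms by simp_all
  then show ?thesis using that[of p] m p r u u1 by auto
qed

section \<open>The operational region\<close>

lemma region_3d_eq:
  assumes "0 < R0" "0 < w"
  shows "region_3d R0 w = region_1 R0 w \<union> region_3d_hat"
proof (rule set_eqI, clarify)
  fix c1 c2 :: real
  show "(c1, c2) \<in> region_3d R0 w \<longleftrightarrow> (c1, c2) \<in> region_1 R0 w \<union> region_3d_hat"
  proof
    assume "(c1, c2) \<in> region_3d R0 w"
    then obtain p where c: "0 < c1" "0 < c2" and p: "0 < p" "p \<le> 1" "0 < gain c1 c2 p"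
      by (auto simp: region_3d_def avg_rate_gt_iff[OF assms])
    note s = gain_pos_imp_sqrt_less[OF c p(1,3)]
    \<comment> \<open>Given \<open>s\<close>, condition \<open>h\<close> says that the point is
      outside \<open>region_3d_hat\<close>. Then positivity passes from \<open>p\<close> to 1:
      either all of the unit interval lies before the peak of
      \<open>p * exp (- c2 * p\<^sup>2)\<close>, or the gain does not peak before 1.\<close>
    have "0 < gain c1 c2 1" if h: "c2 \<le> 1 / 2 \<or> 1 \<le> marginal c1 c2 1"
    proof (cases "p = 1")
      case False
      then have "p < 1" using p by simp
      consider "c2 \<le> 1 / 2" | "1 / 2 < c2" "1 \<le> marginal c1 c2 1"
        using h by fastforce
      then show ?thesis
      proof cases
        case 1
        have "1 < c1 * (p * exp (- c2 * p\<^sup>2))" using p gain_pos_iff by blast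
        also have "\<dots> < c1 * (1 * exp (- c2 * 1\<^sup>2))"
          using 1 c p \<open>p < 1\<close>
          by (intro mult_strict_left_mono mult_exp_neg_square_less) auto
        finally show ?thesis by (subst gain_pos_iff) auto
      next
        case 2
        have "c2 < 1" using marginal_one_less[of c1 c2] c 2 by linarith
        then show ?thesis
          using gain_less_before_peak[of c1 c2 p 1] 2 c p s \<open>p < 1\<close> by auto
      qed
    qed (use p in simp)
    then have "0 < gain c1 c2 1 \<or> 1 / 2 < c2 \<and> marginal c1 c2 1 < 1"
      by (meson not_less)
    then show "(c1, c2) \<in> region_1 R0 w \<union> region_3d_hat"
      using c s by (auto simp: region_1_def avg_rate_gt_iff[OF assms] region_3d_hat_iff not_less)
  next
    assume "(c1, c2) \<in> region_1 R0 w \<union> region_3d_hat"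
    then show "(c1, c2) \<in> region_3d R0 w"
    proof
      assume "(c1, c2) \<in> region_1 R0 w"
      then show ?thesis by (auto simp: region_1_def region_3d_def intro!: bexI[of _ 1])
    next
      assume "(c1, c2) \<in> region_3d_hat"
      then have c: "0 < c1" "1 / 2 < c2" "sqrt (2 * c2 * exp 1) < c1"
        by (auto simp: region_3d_hat_iff)
      \<comment> \<open>A witness need not be optimal: the peak of
        \<open>p * exp (- c2 * p\<^sup>2)\<close> suffices, and \<open>1 / 2 < c2\<close> puts it
        into the unit interval.\<close>
      have "1 / sqrt (2 * c2) \<in> {0<..1}" using c by auto
      moreover have "0 < gain c1 c2 (1 / sqrt (2 * c2))" using c gain_half_pos_iff by simp
      ultimately show ?thesis
        using c unfolding region_3d_def avg_rate_gt_iff[OF assms] by auto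
    qed
  qed
qed

section \<open>The optimal mode selection probability\<close>

lemma x_star_eq_optimal:
  assumes "0 < R0" "0 < w" "(c1, c2) \<in> region_3d_hat"
  shows "\<exists>!x. x_star_eq c1 c2 x"
    and "x_star_eq c1 c2 x \<Longrightarrow> sqrt (x / c2) < 1"
    and "x_star_eq c1 c2 x \<Longrightarrow> optimal_prob R0 w c1 c2 p \<longleftrightarrow> p = sqrt (x / c2)"
proof -
  have c: "0 < c1" "0 < c2" "1 / 2 < c2" "sqrt (2 * c2 * exp 1) < c1" "marginal c1 c2 1 < 1"
    using assms by (auto simp: region_3d_hat_iff)
  obtain p0 where p0: "marginal c1 c2 p0 = 1" "1 / 2 < c2 * p0\<^sup>2" "c2 * p0\<^sup>2 < 1" "0 < p0" "p0 < 1"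
    using critical_point_exists c by metis
  have x0: "x_star_eq c1 c2 (c2 * p0\<^sup>2)" using x_star_eq_iff[of c1 c2 p0] c p0 by blast
  \<comment> \<open>Every solution \<open>x\<close> yields a critical point
    \<open>sqrt (x / c2)\<close>, which uniqueness identifies with \<open>p0\<close>.\<close>
  have x: "sqrt (x / c2) = p0 \<and> x = c2 * p0\<^sup>2" if "x_star_eq c1 c2 x" for x
  proof -
    have "0 < x" using that by (simp add: x_star_eq_def)
    then have sx: "x = c2 * (sqrt (x / c2))\<^sup>2" "0 < sqrt (x / c2)" using c by auto
    then have "x_star_eq c1 c2 (c2 * (sqrt (x / c2))\<^sup>2) \<and> 0 < sqrt (x / c2)"
      using that by simp
    then have "sqrt (x / c2) = p0"
      using x_star_eq_iff[of c1 c2 "sqrt (x / c2)"] x_star_eq_unique[of c1 c2 _ p0] c p0 by blast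
    then show ?thesis using sx by simp
  qed
  show "\<exists>!x. x_star_eq c1 c2 x" using x0 x by blast
  show "x_star_eq c1 c2 x \<Longrightarrow> sqrt (x / c2) < 1" using x p0 by simp
  have "optimal_prob R0 w c1 c2 p \<longleftrightarrow> p = p0"
  proof (rule optimal_prob_unique[OF assms(1,2)])
    show "p0 \<in> {0<..1}" using p0 by simp
    show "gain c1 c2 q < gain c1 c2 p0" if "q \<in> {0<..1}" "q \<noteq> p0" for q
      using gain_less_before_peak[of c1 c2 q p0] gain_greater_after_peak[of c1 c2 p0 q] that c p0
      by (cases "q < p0") auto
  qed
  then show "x_star_eq c1 c2 x \<Longrightarrow> optimal_prob R0 w c1 c2 p \<longleftrightarrow> p = sqrt (x / c2)"
    using x by simp
qed

text \<open>Such a point lies in \<open>region_1\<close>, so the gain at 1 is positive. Either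
  \<open>c2 * p\<^sup>2 \<le> 1 / 2\<close> on the whole interval, or the derivative of the gain is
  still nonnegative at 1; both leave 1 as the only maximizer.\<close>

lemma optimal_prob_one:
  assumes "0 < R0" "0 < w" "(c1, c2) \<in> region_3d R0 w" "(c1, c2) \<notin> region_3d_hat"
  shows "optimal_prob R0 w c1 c2 p \<longleftrightarrow> p = 1"
proof (rule optimal_prob_unique[OF assms(1,2)])
  have "(c1, c2) \<in> region_1 R0 w" using assms region_3d_eq by blast
  then have c: "0 < c1" "0 < c2" "0 < gain c1 c2 1"
    by (auto simp: region_1_def avg_rate_gt_iff[OF assms(1,2)])
  have s: "sqrt (2 * c2 * exp 1) < c1" using gain_pos_imp_sqrt_less[OF c(1,2) _ c(3)] by simp
  show "gain c1 c2 q < gain c1 c2 1" if "q \<in> {0<..1}" "q \<noteq> 1" for q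
  proof (cases "c2 \<le> 1 / 2")
    case True
    then show ?thesis using gain_less_before_half[of q 1 c2 c1] that c by auto
  next
    case False
    then have m: "1 \<le> marginal c1 c2 1" using assms(4) c s by (auto simp: region_3d_hat_iff)
    have "c2 < 1" using marginal_one_less[of c1 c2] c m by linarith
    then show ?thesis using gain_less_before_peak[of c1 c2 q 1] False c s m that by auto
  qed
qed simp

theorem proposition6:
  fixes R0 w :: real
  assumes "R0 > 0" and "w > 0"
  shows "region_3d R0 w = region_1 R0 w \<union> region_3d_hat
    \<and> region_1 R0 w = {(c1, c2). 0 < c1 \<and> 0 < c2 \<and> c1 > exp c2}
    \<and> (\<forall>(c1, c2) \<in> region_3d_hat.
         (\<exists>!x. x_star_eq c1 c2 x)
         \<and> (\<forall>x. x_star_eq c1 c2 x \<longrightarrow>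
              sqrt (x / c2) < 1 \<and> (\<forall>p. optimal_prob R0 w c1 c2 p \<longleftrightarrow> p = sqrt (x / c2))))
    \<and> (\<forall>(c1, c2) \<in> region_3d R0 w - region_3d_hat.
         \<forall>p. optimal_prob R0 w c1 c2 p \<longleftrightarrow> p = 1)"
proof (intro conjI)
  show "region_3d R0 w = region_1 R0 w \<union> region_3d_hat" by (rule region_3d_eq[OF assms])
  show "region_1 R0 w = {(c1, c2). 0 < c1 \<and> 0 < c2 \<and> c1 > exp c2}"
    unfolding region_1_def avg_rate_gt_iff[OF assms] gain_one_pos_iff ..
  show "\<forall>(c1, c2) \<in> region_3d_hat.
         (\<exists>!x. x_star_eq c1 c2 x)
         \<and> (\<forall>x. x_star_eq c1 c2 x \<longrightarrow>
              sqrt (x / c2) < 1 \<and> (\<forall>p. optimal_prob R0 w c1 c2 p \<longleftrightarrow> p = sqrt (x / c2)))"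
  proof (intro ballI case_prodI2 conjI allI impI)
    fix z c1 c2 assume z: "z \<in> region_3d_hat" "z = (c1, c2)"
    then have hat: "(c1, c2) \<in> region_3d_hat" by simp
    note opt = x_star_eq_optimal[OF assms hat]
    show "\<exists>!x. x_star_eq c1 c2 x" by (rule opt(1))
    fix x assume x: "x_star_eq c1 c2 x"
    show "sqrt (x / c2) < 1" by (rule opt(2)[OF x])
    show "optimal_prob R0 w c1 c2 p \<longleftrightarrow> p = sqrt (x / c2)" for p by (rule opt(3)[OF x])
  qed
  show "\<forall>(c1, c2) \<in> region_3d R0 w - region_3d_hat.
         \<forall>p. optimal_prob R0 w c1 c2 p \<longleftrightarrow> p = 1"
    using optimal_prob_one[OF assms] by auto
qed

end
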